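(* Let $X=\{x^{(1)},\dots,x^{(N)}\}\subset\mathbb{R}^d$ be a point cloud of $N$ points (equipped with its connectivity, edge weights, densities and mesh sizes as described in the context), let $\tilde a(x^{(i)})\in\mathbb{R}^{d_a+d+1}$, $1\le i\le N$, be the input values, and let $\mathcal{G}_\theta$ be a (discrete) Point Cloud Neural Operator with arbitrary parameters $\theta$, mapping $$\bigl[u(x^{(1)}),u(x^{(2)}),\dots,u(x^{(N)})\bigr]=\mathcal{G}_\theta\bigl(\tilde a(x^{(1)}),\tilde a(x^{(2)}),\dots,\tilde a(x^{(N)})\bigr).$$ Then for every permutation $\tau:(1,2,\dots,N)\to(\tau_1,\tau_2,\dots,\tau_N)$ of the points, $\mathcal{G}_\theta$ satisfies $$\bigl[u(x^{(\tau_1)}),u(x^{(\tau_2)}),\dots,u(x^{(\tau_N)})\bigr]=\mathcal{G}_\theta\bigl(\tilde a(x^{(\tau_1)}),\tilde a(x^{(\tau_2)}),\dots,\tilde a(x^{(\tau_N)})\bigr).$$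
   Context: Point cloud data. A point cloud representing a domain $\Omega\subset\mathbb{R}^d$ consists of points $x^{(1)},\dots,x^{(N)}$; a neighbor relation (connectivity), where $\mathcal{N}(j)$ denotes the set of indices $i$ such that $x^{(i)}$ is a neighbor of $x^{(j)}$; for each $j$ and each $i\in\mathcal{N}(j)$ a precomputed edge weight $A_i(x^{(j)})^\dagger\in\mathbb{R}^d$; for each point a density value $\rho(x^{(i)};\Omega)>0$ and a mesh size $\mathrm{d}\Omega_i>0$. (The edge weight $A_i(x^{(j)})^\dagger$ is the column associated with the neighbor $x^{(i)}$ of the pseudoinverse, via truncated SVD, of the matrix whose rows are $x^{(l)}-x^{(j)}$, $l\in\mathcal{N}(j)$; it is data attached to the edge from $x^{(j)}$ to $x^{(i)}$.) All of these data are attached to points and edges, not to the numbering. So when the points are renumbered so that the $i$-th point becomes $x^{(\tau_i)}$, the connectivity, edge weights, densities and mesh sizes are renumbered accordingly: in the renumbered cloud the $i$-th point is a neighbor of the $j$-th point if and only if $x^{(\tau_i)}$ is a neighbor of $x^{(\tau_j)}$ in the original cloud, the corresponding edge weight is $A_{\tau_i}(x^{(\tau_j)})^\dagger$, and the $i$-th density and mesh size are $\rho(x^{(\tau_i)};\Omega)$ and $\mathrm{d}\Omega_{\tau_i}$. Input. $\tilde a(x^{(i)})=[a(x^{(i)}),\,x^{(i)},\,\rho(x^{(i)};\Omega)]\in\mathbb{R}^{d_a+d+1}$, where $a$ is a parameter function with values in $\mathbb{R}^{d_a}$. Discrete point cloud neural layer. It maps values $f_{\rm in}(x^{(j)})\in\mathbb{R}^{d_{\rm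 in}}$ to values $f_{\rm out}(x^{(j)})\in\mathbb{R}^{d_{\rm out}}$, $1\le j\le N$, by $$f_{\rm out}(x^{(j)})=\sigma\Bigl(W^l f_{\rm in}(x^{(j)})+b+\sum_{k}\sum_{i=1}^N e^{2\pi \mathrm{i}\frac{k}{L}\cdot(x^{(j)}-x^{(i)})}W^v_k f_{\rm in}(x^{(i)})\,\rho(x^{(i)};\Omega)\,\mathrm{d}\Omega_i+W^g\,\widetilde\nabla f_{\rm in}(x^{(j)})\Bigr).$$ Here $W^l\in\mathbb{R}^{d_{\rm out}\times d_{\rm in}}$ and $b\in\mathbb{R}^{d_{\rm out}}$; $k$ runs over a finite set of frequencies in $\mathbb{Z}^d$; $L\in\mathbb{R}_+^d$ and $k/L$ is the componentwise quotient; $W^v_k\in\mathbb{C}^{d_{\rm out}\times d_{\rm in}}$, where the frequency set is symmetric under $k\mapsto -k$ and $W^v_{-k}=\overline{W^v_k}$ so that the sum is real; $W^g\in\mathbb{R}^{d_{\rm out}\times (d\cdot d_{\rm in})}$; and $\sigma$ is the GeLU activation applied componentwise. The smoothed gradient is $$\widetilde\nabla f_{\rm in}(x^{(j)})=\mathrm{SoftSign}\Bigl(\sum_{i\in\mathcal{N}(j)}A_i(x^{(j)})^\dagger\bigl(f_{\rm in}(x^{(i)})-f_{\rm in}(x^{(j)})\bigr)^T\Bigr)\in\mathbb{R}^{d\times d_{\rm in}},$$ with $\mathrm{SoftSign}(s)=s/(1+|s|)$ applied componentwise, flattened to a vector of length $d\cdot d_{\rm in}$ before multiplication by $W^g$.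 Point Cloud Neural Operator. $\mathcal{G}_\theta$ is a composition of: a lifting layer $f(x^{(j)})=\sigma(W^l\tilde a(x^{(j)})+b)$ applied at each point; finitely many discrete point cloud neural layers; and a projection layer $u(x^{(j)})=W'\sigma(W^l f(x^{(j)})+b)+b'$ applied at each point, with output in $\mathbb{R}^{d_u}$. $\theta$ collects all matrices, biases and length scales. *)

theory Defs
  imports
    "HOL-Probability.Probability"
    "HOL-Combinatorics.Permutations"
    "Jordan_Normal_Form.Matrix"
begin

unbundle no vec_syntax
unbundle no inner_syntax

section \<open>Point clouds\<close>

text \<open>Points are numbered \<open>1, \<dots>, N\<close>. Vectors and matrices carry their dimension as a value,
  because the layers of one network have different widths; their coordinates count from \<open>0\<close>.
  \<open>edge_weight C j i\<close> is the weight of the edge from the \<open>j\<close>-th point to its neighbor \<open>i\<close>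
  and is only read for \<open>i \<in> neighbors C j\<close>.\<close>

record point_cloud =
  amb_dim :: nat
  num_points :: nat
  point :: "nat \<Rightarrow> real vec"
  neighbors :: "nat \<Rightarrow> nat set"
  edge_weight :: "nat \<Rightarrow> nat \<Rightarrow> real vec"
  point_density :: "nat \<Rightarrow> real"
  mesh_size :: "nat \<Rightarrow> real"

definition indices :: "point_cloud \<Rightarrow> nat set" where
  "indices C = {1..num_points C}"

definition wf_point_cloud :: "nat \<Rightarrow> real vec set \<Rightarrow> nat \<Rightarrow> point_cloud \<Rightarrow> bool" where
  "wf_point_cloud d \<Omega> N C \<longleftrightarrow>
     amb_dim C = d \<and> num_points C = N \<and> \<Omega> \<subseteq> carrier_vec d \<and>
     (\<forall>j \<in> indices C.
        point C j \<in> \<Omega> \<and>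
        neighbors C j \<subseteq> indices C \<and>
        (\<forall>i \<in> neighbors C j. edge_weight C j i \<in> carrier_vec d) \<and>
        point_density C j > 0 \<and> mesh_size C j > 0)"

text \<open>The cloud whose \<open>i\<close>-th point is the \<open>\<tau> i\<close>-th point of \<open>C\<close>.\<close>

definition renumber :: "(nat \<Rightarrow> nat) \<Rightarrow> point_cloud \<Rightarrow> point_cloud" where
  "renumber \<tau> C =
     \<lparr> amb_dim = amb_dim C,
       num_points = num_points C,
       point = (\<lambda>i. point C (\<tau> i)),
       neighbors = (\<lambda>j. {i \<in> indices C. \<tau> i \<in> neighbors C (\<tau> j)}),
       edge_weight = (\<lambda>j i. edge_weight C (\<tau> j) (\<tau> i)),
       point_density = (\<lambda>i. point_density C (\<tau> i)),
       mesh_size = (\<lambda>i. mesh_size C (\<tau> i)) \<rparr>"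

definition input_value :: "(real vec \<Rightarrow> real vec) \<Rightarrow> point_cloud \<Rightarrow> nat \<Rightarrow> real vec" where
  "input_value a C i = a (point C i) @\<^sub>v point C i @\<^sub>v vec_of_list [point_density C i]"


section \<open>Activation functions\<close>

definition gelu :: "real \<Rightarrow> real" where
  "gelu x = x * cdf std_normal_distribution x"

definition softsign :: "real \<Rightarrow> real" where
  "softsign s = s / (1 + \<bar>s\<bar>)"


section \<open>The discrete point cloud neural layer\<close>

record pcn_layer =
  local_weight :: "real mat"
  bias :: "real vec"
  frequencies :: "int vec set"
  length_scale :: "real vec"
  spectral_weight :: "int vec \<Rightarrow> complex mat"
  gradient_weight :: "real mat"

definition wf_pcn_layer :: "nat \<Rightarrow> nat \<Rightarrow> nat \<Rightarrow> pcn_layer \<Rightarrow> bool" where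
  "wf_pcn_layer d d_in d_out \<Lambda> \<longleftrightarrow>
     local_weight \<Lambda> \<in> carrier_mat d_out d_in \<and>
     bias \<Lambda> \<in> carrier_vec d_out \<and>
     finite (frequencies \<Lambda>) \<and> frequencies \<Lambda> \<subseteq> carrier_vec d \<and>
     length_scale \<Lambda> \<in> carrier_vec d \<and> (\<forall>r<d. length_scale \<Lambda> $ r > 0) \<and>
     (\<forall>k \<in> frequencies \<Lambda>.
        spectral_weight \<Lambda> k \<in> carrier_mat d_out d_in \<and>
        - k \<in> frequencies \<Lambda> \<and>
        spectral_weight \<Lambda> (- k) = map_mat cnj (spectral_weight \<Lambda> k)) \<and>
     gradient_weight \<Lambda> \<in> carrier_mat d_out (d * d_in)"

definition scaled_freq :: "int vec \<Rightarrow> real vec \<Rightarrow> real vec" where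
  "scaled_freq k L = vec (dim_vec L) (\<lambda>r. real_of_int (k $ r) / L $ r)"

definition spectral_sum :: "pcn_layer \<Rightarrow> point_cloud \<Rightarrow> (nat \<Rightarrow> real vec) \<Rightarrow> nat \<Rightarrow> complex vec" where
  "spectral_sum \<Lambda> C f j = vec (dim_row (local_weight \<Lambda>)) (\<lambda>r.
     \<Sum>k \<in> frequencies \<Lambda>. \<Sum>i \<in> indices C.
       exp (2 * complex_of_real pi * \<i> *
            complex_of_real (scaled_freq k (length_scale \<Lambda>) \<bullet> (point C j - point C i))) *
       (spectral_weight \<Lambda> k *\<^sub>v map_vec complex_of_real (f i)) $ r *
       complex_of_real (point_density C i * mesh_size C i))"

text \<open>Entry \<open>(r, c)\<close> is the smoothed partial derivative in direction \<open>r\<close> of component \<open>c\<close>.\<close>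

definition smoothed_gradient :: "point_cloud \<Rightarrow> (nat \<Rightarrow> real vec) \<Rightarrow> nat \<Rightarrow> real mat" where
  "smoothed_gradient C f j = map_mat softsign
     (mat (amb_dim C) (dim_vec (f j)) (\<lambda>(r, c).
        \<Sum>i \<in> neighbors C j. edge_weight C j i $ r * (f i - f j) $ c))"

text \<open>Row-major flattening.\<close>

definition flatten :: "'a mat \<Rightarrow> 'a vec" where
  "flatten M = vec (dim_row M * dim_col M) (\<lambda>t. M $$ (t div dim_col M, t mod dim_col M))"

text \<open>For a well-formed layer the spectral sum is real, so taking the real part only changes
  the type; see \<open>spectral_sum_real\<close> below.\<close>

definition pcn_layer_map :: "pcn_layer \<Rightarrow> point_cloud \<Rightarrow> (nat \<Rightarrow> real vec) \<Rightarrow> nat \<Rightarrow> real vec" where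
  "pcn_layer_map \<Lambda> C f j = map_vec gelu
     (local_weight \<Lambda> *\<^sub>v f j + bias \<Lambda> + map_vec Re (spectral_sum \<Lambda> C f j)
      + gradient_weight \<Lambda> *\<^sub>v flatten (smoothed_gradient C f j))"

lemma cnj_mult_mat_vec_of_real:
  assumes "W \<in> carrier_mat m n" "v \<in> carrier_vec n" "r < m"
  shows "cnj ((W *\<^sub>v map_vec complex_of_real v) $ r)
       = (map_mat cnj W *\<^sub>v map_vec complex_of_real v) $ r"
  using assms by (auto simp: scalar_prod_def cnj_sum)

lemma scaled_freq_uminus:
  assumes "k \<in> carrier_vec d" "L \<in> carrier_vec d" "y \<in> carrier_vec d"
  shows "scaled_freq (- k) L \<bullet> y = - (scaled_freq k L \<bullet> y)"
  using assms by (auto simp: scaled_freq_def scalar_prod_def sum_negf[symmetric])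

lemma spectral_sum_real:
  assumes C: "wf_point_cloud d \<Omega> N C" and \<Lambda>: "wf_pcn_layer d d_in d_out \<Lambda>"
    and f: "\<And>i. i \<in> indices C \<Longrightarrow> f i \<in> carrier_vec d_in"
    and j: "j \<in> indices C" and r: "r < d_out"
  shows "spectral_sum \<Lambda> C f j $ r \<in> \<real>"
proof -
  let ?K = "frequencies \<Lambda>"
  define t where "t k i = exp (2 * complex_of_real pi * \<i> *
            complex_of_real (scaled_freq k (length_scale \<Lambda>) \<bullet> (point C j - point C i))) *
       (spectral_weight \<Lambda> k *\<^sub>v map_vec complex_of_real (f i)) $ r *
       complex_of_real (point_density C i * mesh_size C i)" for k i
  have pts: "point C i \<in> carrier_vec d" if "i \<in> indices C" for i
    using C that by (auto simp: wf_point_cloud_def)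
  have cnj_t: "cnj (t k i) = t (- k) i" if k: "k \<in> ?K" and i: "i \<in> indices C" for k i
  proof -
    have kc: "k \<in> carrier_vec d" "length_scale \<Lambda> \<in> carrier_vec d"
      "spectral_weight \<Lambda> k \<in> carrier_mat d_out d_in"
      "spectral_weight \<Lambda> (- k) = map_mat cnj (spectral_weight \<Lambda> k)"
      using \<Lambda> k by (auto simp: wf_pcn_layer_def)
    have y: "point C j - point C i \<in> carrier_vec d"
      using pts[OF i] pts[OF j] by auto
    show ?thesis
      unfolding t_def kc(4) scaled_freq_uminus[OF kc(1,2) y]
      by (simp add: exp_cnj cnj_mult_mat_vec_of_real[OF kc(3) f[OF i] r, symmetric] del: index_mult_mat_vec)
  qed
  have bij: "bij_betw uminus ?K ?K"
    by (rule bij_betwI[where g = uminus]) (use \<Lambda> in \<open>auto simp: wf_pcn_layer_def\<close>)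
  have "cnj (\<Sum>k \<in> ?K. \<Sum>i \<in> indices C. t k i) = (\<Sum>k \<in> ?K. \<Sum>i \<in> indices C. t (- k) i)"
    by (simp add: cnj_sum cnj_t)
  also have "\<dots> = (\<Sum>k \<in> ?K. \<Sum>i \<in> indices C. t k i)"
    using sum.reindex_bij_betw[OF bij] .
  finally have "(\<Sum>k \<in> ?K. \<Sum>i \<in> indices C. t k i) \<in> \<real>"
    by (simp add: Reals_cnj_iff)
  moreover have "r < dim_row (local_weight \<Lambda>)"
    using \<Lambda> r by (auto simp: wf_pcn_layer_def)
  ultimately show ?thesis
    by (simp add: spectral_sum_def t_def)
qed


section \<open>The Point Cloud Neural Operator\<close>

record pcno_params =
  lift_weight :: "real mat"
  lift_bias :: "real vec"
  layers :: "pcn_layer list"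
  proj_weight :: "real mat"
  proj_bias :: "real vec"
  out_weight :: "real mat"
  out_bias :: "real vec"

fun wf_layers :: "nat \<Rightarrow> nat \<Rightarrow> pcn_layer list \<Rightarrow> nat \<Rightarrow> bool" where
  "wf_layers d d_in [] d_out \<longleftrightarrow> d_in = d_out"
| "wf_layers d d_in (\<Lambda> # \<Lambda>s) d_out \<longleftrightarrow>
     (\<exists>d_mid. wf_pcn_layer d d_in d_mid \<Lambda> \<and> wf_layers d d_mid \<Lambda>s d_out)"

definition wf_pcno :: "nat \<Rightarrow> nat \<Rightarrow> nat \<Rightarrow> pcno_params \<Rightarrow> bool" where
  "wf_pcno d d_in d_u \<theta> \<longleftrightarrow> (\<exists>d_first d_last d_hidden.
     lift_weight \<theta> \<in> carrier_mat d_first d_in \<and>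
     lift_bias \<theta> \<in> carrier_vec d_first \<and>
     wf_layers d d_first (layers \<theta>) d_last \<and>
     proj_weight \<theta> \<in> carrier_mat d_hidden d_last \<and>
     proj_bias \<theta> \<in> carrier_vec d_hidden \<and>
     out_weight \<theta> \<in> carrier_mat d_u d_hidden \<and>
     out_bias \<theta> \<in> carrier_vec d_u)"

definition lifting :: "pcno_params \<Rightarrow> (nat \<Rightarrow> real vec) \<Rightarrow> nat \<Rightarrow> real vec" where
  "lifting \<theta> g j = map_vec gelu (lift_weight \<theta> *\<^sub>v g j + lift_bias \<theta>)"

definition projection :: "pcno_params \<Rightarrow> (nat \<Rightarrow> real vec) \<Rightarrow> nat \<Rightarrow> real vec" where
  "projection \<theta> f j =
     out_weight \<theta> *\<^sub>v map_vec gelu (proj_weight \<theta> *\<^sub>v f j + proj_bias \<theta>) + out_bias \<theta>"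

text \<open>\<open>pcno \<theta> C g\<close> is the tuple of outputs on the cloud \<open>C\<close> for the tuple of inputs \<open>g\<close>;
  tuples are functions of the point number, meaningful on \<open>indices C\<close>.\<close>

definition pcno :: "pcno_params \<Rightarrow> point_cloud \<Rightarrow> (nat \<Rightarrow> real vec) \<Rightarrow> nat \<Rightarrow> real vec" where
  "pcno \<theta> C g = projection \<theta> (fold (\<lambda>\<Lambda> f. pcn_layer_map \<Lambda> C f) (layers \<theta>) (lifting \<theta> g))"

end

theory Submission
  imports Defs
begin

text \<open>The operator is built from three kinds of operations on a tuple of values attached to the
  points: a map applied at each point separately, a sum over all points, and a sum over the
  neighbors of a point. The first kind commutes with any renumbering. In the two sums each
  summand depends only on data attached to points and edges, so renumbering by \<open>\<tau>\<close> amounts to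
  the substitution \<open>i \<mapsto> \<tau> i\<close> in the summation index. This substitution leaves the sum unchanged
  because \<open>\<tau>\<close> is a bijection of the index set and, by the definition of the renumbered
  connectivity, also a bijection from the neighbors of \<open>j\<close> in the renumbered cloud onto the
  neighbors of \<open>\<tau> j\<close> in the original one (\<open>bij_betw_renumber_neighbors\<close>).

  Hence every layer is equivariant (\<open>pcn_layer_map_renumber\<close>), and so is a composition of layers,
  by induction. The induction works with tuples that correspond under \<open>\<tau>\<close> on the index set
  only: off the index set the values of a layer carry no meaning, and the neighbors there are
  unrestricted, so equality of the functions on all natural numbers would be too strong an
  invariant.\<close>

lemma indices_renumber [simp]: "indices (renumber \<tau> C) = indices C"
  by (simp add: indices_def renumber_def)

text \<open>The renumbered neighborhood is by definition the part of the preimage under \<open>\<tau>\<close> that lies in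
  the index set. It hits every neighbor of \<open>\<tau> j\<close> because these neighbors are indices and \<open>\<tau>\<close> maps
  the index set onto itself.\<close>

lemma bij_betw_renumber_neighbors:
  assumes "\<tau> permutes indices C" and "neighbors C (\<tau> j) \<subseteq> indices C"
  shows "bij_betw \<tau> (neighbors (renumber \<tau> C) j) (neighbors C (\<tau> j))"
proof -
  have "neighbors (renumber \<tau> C) j = {i \<in> indices C. \<tau> i \<in> neighbors C (\<tau> j)}"
    by (simp add: renumber_def)
  moreover have "\<tau> ` {i \<in> indices C. \<tau> i \<in> neighbors C (\<tau> j)} = neighbors C (\<tau> j)"
  proof (intro equalityI subsetI)
    fix k assume k: "k \<in> neighbors C (\<tau> j)"
    then have "k \<in> \<tau> ` indices C"
      unfolding permutes_image[OF assms(1)] using assms(2) by (rule subsetD[rotated])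
    with k show "k \<in> \<tau> ` {i \<in> indices C. \<tau> i \<in> neighbors C (\<tau> j)}"
      by auto
  qed auto
  moreover have "inj_on \<tau> {i \<in> indices C. \<tau> i \<in> neighbors C (\<tau> j)}"
    using permutes_inj_on[OF assms(1)] .
  ultimately show ?thesis
    by (simp add: bij_betw_def)
qed

lemma spectral_sum_renumber:
  assumes \<tau>: "\<tau> permutes indices C"
    and f: "\<And>i. i \<in> indices C \<Longrightarrow> f' i = f (\<tau> i)"
  shows "spectral_sum \<Lambda> (renumber \<tau> C) f' j = spectral_sum \<Lambda> C f (\<tau> j)"
proof -
  let ?t = "\<lambda>r k i. exp (2 * complex_of_real pi * \<i> *
        complex_of_real (scaled_freq k (length_scale \<Lambda>) \<bullet> (point C (\<tau> j) - point C i))) *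
      (spectral_weight \<Lambda> k *\<^sub>v map_vec complex_of_real (f i)) $ r *
      complex_of_real (point_density C i * mesh_size C i)"
  have reindex: "(\<Sum>i \<in> indices C. ?t r k (\<tau> i)) = (\<Sum>i \<in> indices C. ?t r k i)" for r k
    by (rule sum.reindex_bij_betw[OF permutes_imp_bij[OF \<tau>], where g = "?t r k"])
  have "spectral_sum \<Lambda> (renumber \<tau> C) f' j = vec (dim_row (local_weight \<Lambda>)) (\<lambda>r.
      \<Sum>k \<in> frequencies \<Lambda>. \<Sum>i \<in> indices C. ?t r k (\<tau> i))"
    unfolding spectral_sum_def indices_renumber
    by (intro arg_cong[where f = "vec (dim_row (local_weight \<Lambda>))"] ext sum.cong refl)
      (simp only: f, simp only: renumber_def point_cloud.simps)
  also have "\<dots> = spectral_sum \<Lambda> C f (\<tau> j)"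
    by (simp only: reindex spectral_sum_def)
  finally show ?thesis .
qed

lemma smoothed_gradient_renumber:
  assumes \<tau>: "\<tau> permutes indices C"
    and nb: "neighbors C (\<tau> j) \<subseteq> indices C"
    and f: "\<And>i. i \<in> indices C \<Longrightarrow> f' i = f (\<tau> i)"
    and j: "j \<in> indices C"
  shows "smoothed_gradient (renumber \<tau> C) f' j = smoothed_gradient C f (\<tau> j)"
proof -
  have edge: "(\<Sum>i \<in> neighbors (renumber \<tau> C) j.
                 edge_weight (renumber \<tau> C) j i $ r * (f' i - f' j) $ c)
       = (\<Sum>i \<in> neighbors C (\<tau> j). edge_weight C (\<tau> j) i $ r * (f i - f (\<tau> j)) $ c)" for r c
  proof -
    have "(\<Sum>i \<in> neighbors (renumber \<tau> C) j.
             edge_weight (renumber \<tau> C) j i $ r * (f' i - f' j) $ c)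
        = (\<Sum>i \<in> neighbors (renumber \<tau> C) j.
             edge_weight C (\<tau> j) (\<tau> i) $ r * (f (\<tau> i) - f (\<tau> j)) $ c)"
      by (rule sum.cong) (auto simp: renumber_def f j)
    also have "\<dots> = (\<Sum>i \<in> neighbors C (\<tau> j). edge_weight C (\<tau> j) i $ r * (f i - f (\<tau> j)) $ c)"
      by (rule sum.reindex_bij_betw[OF bij_betw_renumber_neighbors[OF \<tau> nb]])
    finally show ?thesis .
  qed
  have dim: "amb_dim (renumber \<tau> C) = amb_dim C"
    by (simp add: renumber_def)
  show ?thesis
    unfolding smoothed_gradient_def edge by (simp only: f[OF j] dim)
qed

lemma pcn_layer_map_renumber:
  assumes \<tau>: "\<tau> permutes indices C"
    and nb: "neighbors C (\<tau> j) \<subseteq> indices C"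
    and f: "\<And>i. i \<in> indices C \<Longrightarrow> f' i = f (\<tau> i)"
    and j: "j \<in> indices C"
  shows "pcn_layer_map \<Lambda> (renumber \<tau> C) f' j = pcn_layer_map \<Lambda> C f (\<tau> j)"
  by (simp only: pcn_layer_map_def f[OF j]
      spectral_sum_renumber[where f = f and f' = f', OF \<tau> f]
      smoothed_gradient_renumber[where f = f and f' = f', OF \<tau> nb f j])

text \<open>The neighborhood condition is required of all indices here, not only of \<open>\<tau> j\<close>: after the first
  layer the value at \<open>j\<close> depends on values at other points, which must correspond as well. For the
  same reason the two input tuples are generalized in the induction.\<close>

lemma fold_pcn_layer_map_renumber:
  assumes \<tau>: "\<tau> permutes indices C"
    and nb: "\<And>j. j \<in> indices C \<Longrightarrow> neighbors C j \<subseteq> indices C"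
    and f: "\<And>i. i \<in> indices C \<Longrightarrow> f' i = f (\<tau> i)"
    and j: "j \<in> indices C"
  shows "fold (\<lambda>\<Lambda> f. pcn_layer_map \<Lambda> (renumber \<tau> C) f) \<Lambda>s f' j
       = fold (\<lambda>\<Lambda> f. pcn_layer_map \<Lambda> C f) \<Lambda>s f (\<tau> j)"
  using f
proof (induction \<Lambda>s arbitrary: f f')
  case Nil
  then show ?case
    using j by simp
next
  case (Cons \<Lambda> \<Lambda>s)
  have "pcn_layer_map \<Lambda> (renumber \<tau> C) f' i = pcn_layer_map \<Lambda> C f (\<tau> i)"
    if i: "i \<in> indices C" for i
  proof (rule pcn_layer_map_renumber[where f' = f' and f = f, OF \<tau> _ Cons.prems i])
    show "neighbors C (\<tau> i) \<subseteq> indices C"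
      by (rule nb) (simp only: permutes_in_image[OF \<tau>] i)
  qed
  then show ?case
    using Cons.IH by simp
qed

lemma pcno_renumber:
  assumes "\<tau> permutes indices C"
    and "\<And>j. j \<in> indices C \<Longrightarrow> neighbors C j \<subseteq> indices C"
    and "j \<in> indices C"
  shows "pcno \<theta> (renumber \<tau> C) (\<lambda>l. g (\<tau> l)) j = pcno \<theta> C g (\<tau> j)"
proof -
  have "lifting \<theta> (\<lambda>l. g (\<tau> l)) i = lifting \<theta> g (\<tau> i)" for i
    by (simp add: lifting_def)
  then show ?thesis
    by (simp only: pcno_def projection_def
        fold_pcn_layer_map_renumber[where f' = "lifting \<theta> (\<lambda>l. g (\<tau> l))" and f = "lifting \<theta> g",
          OF assms(1,2) _ assms(3)])
qed

theorem theorem1: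
  fixes d d_a d_u N :: nat
    and \<Omega> :: "real vec set" and C :: point_cloud
    and a :: "real vec \<Rightarrow> real vec"
    and a_tilde u :: "nat \<Rightarrow> real vec"
    and \<theta> :: pcno_params
    and \<tau> :: "nat \<Rightarrow> nat"
  assumes "wf_point_cloud d \<Omega> N C"
    and "\<forall>x \<in> \<Omega>. a x \<in> carrier_vec d_a"
    and "\<forall>i \<in> {1..N}. a_tilde i = input_value a C i"
    and "wf_pcno d (d_a + d + 1) d_u \<theta>"
    and "\<forall>i \<in> {1..N}. u i = pcno \<theta> C a_tilde i"
    and "\<tau> permutes {1..N}"
  shows "\<forall>i \<in> {1..N}. u (\<tau> i) = pcno \<theta> (renumber \<tau> C) (\<lambda>l. a_tilde (\<tau> l)) i"
proof
  fix i assume i: "i \<in> {1..N}"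
  have ind: "indices C = {1..N}"
    and nb: "\<And>j. j \<in> indices C \<Longrightarrow> neighbors C j \<subseteq> indices C"
    using assms(1) by (auto simp: wf_point_cloud_def indices_def)
  have "\<tau> i \<in> {1..N}"
    by (simp only: permutes_in_image[OF assms(6)] i)
  then have "u (\<tau> i) = pcno \<theta> C a_tilde (\<tau> i)"
    using assms(5) by blast
  also have "\<dots> = pcno \<theta> (renumber \<tau> C) (\<lambda>l. a_tilde (\<tau> l)) i"
    using pcno_renumber[OF _ nb] assms(6) i by (simp add: ind)
  finally show "u (\<tau> i) = pcno \<theta> (renumber \<tau> C) (\<lambda>l. a_tilde (\<tau> l)) i" .
qed

end
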